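(* Let $n\geq 1$ be an integer. Every fuzzy vector $u\in\mathcal{F}^n$ has a unique Mareš core if, and only if, the dimension $n=1$.
   Context: $O(n)$ is the group of $n\times n$ orthogonal matrices. A fuzzy vector (of dimension $n$) is a function $u:\mathbb{R}^n\to[0,1]$ such that: (V1) there is $t_0\in\mathbb{R}^n$ with $u(t_0)=1$; (V2) the closure of $\{t\in\mathbb{R}^n\mid u(t)>0\}$ is compact; (V3) $\min(u(s),u(t))\leq u(\lambda s+(1-\lambda)t)$ for all $s,t\in\mathbb{R}^n$ and $\lambda\in[0,1]$; (V4) $\{t\in\mathbb{R}^n\mid u(t)\geq\alpha\}$ is closed for all $\alpha\in[0,1]$. $\mathcal{F}^n$ is the set of all fuzzy vectors of dimension $n$. The sum is $(u\oplus v)(t):=\sup_{r+s=t}\min(u(r),v(s))$. A fuzzy vector $u$ is symmetric if $u(t)=u(Qt)$ for all $t\in\mathbb{R}^n$, $Q\in O(n)$; $\mathcal{F}^n_{\mathsf{s}}$ is the set of symmetric fuzzy vectors. $\tilde{o}$ is the fuzzy vector with value $1$ at the origin and $0$ elsewhere. A fuzzy vector $u$ is skew if whenever $u=v\oplus w$ with $v\in\mathcal{F}^n$ and $w\in\mathcal{F}^n_{\mathsf{s}}$, then $w=\tilde{o}$. A fuzzy vector $v\in\mathcal{F}^n$ is a Mareš core of $u\in\mathcal{F}^n$ if $v$ is skew and $u=v\oplus w$ for some $w\in\mathcal{F}^n_{\mathsf{s}}$. *)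

theory Defs
  imports "HOL-Analysis.Analysis"
begin

definition fuzzy_vectors :: "(real ^ 'n \<Rightarrow> real) set" where
  "fuzzy_vectors = {u.
     (\<forall>t. u t \<in> {0..1}) \<and>
     (\<exists>t\<^sub>0. u t\<^sub>0 = 1) \<and>
     compact (closure {t. u t > 0}) \<and>
     (\<forall>s t. \<forall>c\<in>{0..1}. min (u s) (u t) \<le> u (c *\<^sub>R s + (1 - c) *\<^sub>R t)) \<and>
     (\<forall>\<alpha>\<in>{0..1}. closed {t. u t \<ge> \<alpha>})}"

(* For [0,1]-valued arguments the set below is nonempty and bounded above,
   so the real-valued SUP is a genuine supremum. *)
definition fuzzy_add ::
  "(real ^ 'n \<Rightarrow> real) \<Rightarrow> (real ^ 'n \<Rightarrow> real) \<Rightarrow> real ^ 'n \<Rightarrow> real"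
  (infixl "\<oplus>\<^sub>F" 65) where
  "(u \<oplus>\<^sub>F v) t = (SUP (r, s) \<in> {(r, s). r + s = t}. min (u r) (v s))"

definition symmetric_fuzzy_vectors :: "(real ^ 'n \<Rightarrow> real) set" where
  "symmetric_fuzzy_vectors =
     {u \<in> fuzzy_vectors. \<forall>t. \<forall>Q :: real ^ 'n ^ 'n. orthogonal_matrix Q \<longrightarrow> u t = u (Q *v t)}"

definition fuzzy_origin :: "real ^ 'n \<Rightarrow> real" where
  "fuzzy_origin t = (if t = 0 then 1 else 0)"

definition skew_fuzzy_vector :: "(real ^ 'n \<Rightarrow> real) \<Rightarrow> bool" where
  "skew_fuzzy_vector u \<longleftrightarrow> u \<in> fuzzy_vectors \<and>
     (\<forall>v \<in> fuzzy_vectors. \<forall>w \<in> symmetric_fuzzy_vectors. u = v \<oplus>\<^sub>F w \<longrightarrow> w = fuzzy_origin)"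

definition mares_core :: "(real ^ 'n \<Rightarrow> real) \<Rightarrow> (real ^ 'n \<Rightarrow> real) \<Rightarrow> bool" where
  "mares_core v u \<longleftrightarrow> v \<in> fuzzy_vectors \<and> skew_fuzzy_vector v \<and>
     (\<exists>w \<in> symmetric_fuzzy_vectors. u = v \<oplus>\<^sub>F w)"

end

theory Submission
  imports Defs
begin

text \<open>A fuzzy vector is determined by its \<open>\<alpha>\<close>-cuts for \<open>0 < \<alpha> \<le> 1\<close>, and \<open>\<oplus>\<^sub>F\<close> adds cuts in the
  sense of Minkowski. A symmetric summand has balls around the origin as its cuts.

  In dimension one the cuts of \<open>u\<close> are intervals \<open>[a \<alpha>, b \<alpha>]\<close>, and adding a symmetric vector leaves
  \<open>m = a + b\<close>, twice the midpoint, unchanged. Nestedness of the cuts means that the width \<open>b - a\<close>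
  decreases, along every step in \<open>\<alpha>\<close>, by at least the amount by which \<open>m\<close> moves. So the
  width is at least the total variation \<open>V\<close> of \<open>m\<close> on \<open>[\<alpha>, 1]\<close>, and the excess over \<open>V\<close> is itself
  nonnegative, decreasing and left continuous in \<open>\<alpha>\<close>: it is the width of a symmetric vector, and what
  remains when it is split off has width exactly \<open>V\<close> (lemma \<open>core_decomposition\<close>). Hence \<open>u\<close> is skew
  if and only if its width equals the variation of \<open>m\<close> (lemma \<open>skew_iff_width_eq_variation\<close>). Since
  \<open>u\<close> and its cores share the same \<open>m\<close>, a core has the endpoints \<open>(m - V) / 2\<close> and \<open>(m + V) / 2\<close>;
  this gives existence and uniqueness at once.

  From dimension two on a second constraint appears: the cut that is left after removing a ball must
  still be convex. A cube has no ball as a summand, because at a corner two facets with different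
  normals meet (lemma \<open>skew_if_support_cube\<close>). Write \<open>K \<le> L\<close> for the vector whose cuts are \<open>L\<close> up
  to the level \<open>1/2\<close> and \<open>K\<close> above it, and let \<open>B\<close> be the unit ball and \<open>C\<close> the cube. The vector
  \<open>B \<le> C + B\<close> is both \<open>({0} \<le> C) \<oplus> (B \<le> B)\<close> and \<open>(B \<le> C) \<oplus> ({0} \<le> B)\<close>: the ball in its lower cut
  can be split off together with the upper cut or without it. This yields two different cores
  (lemma \<open>two_cores\<close>).\<close>

section \<open>Sums and radial symmetry in every dimension\<close>

lemma fuzzy_vector_range:
  assumes "u \<in> fuzzy_vectors"
  shows "0 \<le> u t" "u t \<le> 1"
  using assms unfolding fuzzy_vectors_def by auto

lemma bdd_above_fuzzy_add:
  fixes u v :: "real ^ 'n \<Rightarrow> real"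
  assumes "\<And>t. u t \<le> 1"
  shows "bdd_above ((\<lambda>(r, s). min (u r) (v s)) ` {(r, s). r + s = t})"
  using assms by (intro bdd_aboveI[of _ 1]) (auto simp: min_le_iff_disj)

lemma fuzzy_add_ge:
  assumes "\<And>t. u t \<le> 1"
  shows "min (u r) (v s) \<le> (u \<oplus>\<^sub>F v) (r + s)"
proof -
  have "(\<lambda>(r, s). min (u r) (v s)) (r, s) \<le> (u \<oplus>\<^sub>F v) (r + s)"
    unfolding fuzzy_add_def
    by (rule cSUP_upper) (auto intro: bdd_above_fuzzy_add assms)
  then show ?thesis by simp
qed

text \<open>The supremum in \<open>\<oplus>\<^sub>F\<close> is used only through strict lower bounds, which avoids proving that it is
  attained.\<close>

lemma fuzzy_add_approx:
  fixes u v :: "real ^ 'n \<Rightarrow> real"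
  assumes "\<And>t. u t \<le> 1" and "c < (u \<oplus>\<^sub>F v) t"
  obtains r s where "r + s = t" "c < u r" "c < v s"
proof -
  have ne: "{(r, s). r + s = t} \<noteq> {}"
  proof -
    have "(t, 0) \<in> {(r, s). r + s = t}" by simp
    then show ?thesis by blast
  qed
  from assms(2) have "\<exists>p\<in>{(r, s). r + s = t}. c < (\<lambda>(r, s). min (u r) (v s)) p"
    unfolding fuzzy_add_def
    by (subst (asm) less_cSUP_iff[OF ne bdd_above_fuzzy_add[of u, OF assms(1)]]) auto
  then show ?thesis using that by auto
qed

lemma fuzzy_add_range:
  assumes "\<And>t. 0 \<le> u t \<and> u t \<le> 1" and "\<And>t. 0 \<le> v t \<and> v t \<le> 1"
  shows "0 \<le> (u \<oplus>\<^sub>F v) t \<and> (u \<oplus>\<^sub>F v) t \<le> 1"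
proof
  show "0 \<le> (u \<oplus>\<^sub>F v) t"
    using fuzzy_add_ge[of u t v 0] assms by (smt (verit) add.right_neutral)
  show "(u \<oplus>\<^sub>F v) t \<le> 1"
  proof (rule ccontr)
    assume "\<not> ?thesis"
    then obtain r s where "1 < u r" using fuzzy_add_approx[of u 1 v t] assms by force
    then show False using assms(1)[of r] by simp
  qed
qed

text \<open>Orthogonal matrices preserve the norm, and they act transitively on every sphere around the
  origin.\<close>

lemma symmetric_iff_radial:
  fixes w :: "real ^ 'n \<Rightarrow> real"
  shows "w \<in> symmetric_fuzzy_vectors \<longleftrightarrow>
    w \<in> fuzzy_vectors \<and> (\<forall>s t. norm s = norm t \<longrightarrow> w s = w t)"
proof (intro iffI conjI allI impI)
  assume w: "w \<in> symmetric_fuzzy_vectors"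
  then show "w \<in> fuzzy_vectors" by (simp add: symmetric_fuzzy_vectors_def)
  fix s t :: "real ^ 'n"
  assume "norm s = norm t"
  then obtain f where f: "orthogonal_transformation f" "f s = t"
    by (rule orthogonal_transformation_exists)
  then have "orthogonal_matrix (matrix f)" and t: "matrix f *v s = t"
    by (auto simp: orthogonal_transformation_matrix matrix_works)
  then have "w s = w (matrix f *v s)"
    using w unfolding symmetric_fuzzy_vectors_def by blast
  then show "w s = w t" by (simp only: t)
next
  assume w: "w \<in> fuzzy_vectors \<and> (\<forall>s t. norm s = norm t \<longrightarrow> w s = w t)"
  have "norm t = norm (Q *v t)" if "orthogonal_matrix Q" for t :: "real ^ 'n" and Q :: "real ^ 'n ^ 'n"
    using that by (simp add: orthogonal_transformation_norm orthogonal_transformation_matrix)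
  then show "w \<in> symmetric_fuzzy_vectors"
    using w unfolding symmetric_fuzzy_vectors_def by blast
qed

section \<open>Two cores in dimension at least two\<close>

definition two_level :: "(real ^ 'n) set \<Rightarrow> (real ^ 'n) set \<Rightarrow> real ^ 'n \<Rightarrow> real" where
  "two_level K L t = (if t \<in> K then 1 else if t \<in> L then 1/2 else 0)"

lemma two_level_fuzzy_vector:
  fixes K L :: "(real ^ 'n) set"
  assumes "compact K" "convex K" "K \<noteq> {}" "compact L" "convex L" "K \<subseteq> L"
  shows "two_level K L \<in> fuzzy_vectors"
proof -
  have supp: "{t. two_level K L t > 0} = L"
    using assms by (auto simp: two_level_def)
  have cut: "{t. \<alpha> \<le> two_level K L t} = (if \<alpha> \<le> 0 then UNIV else if \<alpha> \<le> 1/2 then L else K)"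
    if "\<alpha> \<in> {0..1}" for \<alpha>
    using assms that by (auto simp: two_level_def)
  have conv: "min (two_level K L s) (two_level K L t) \<le> two_level K L (c *\<^sub>R s + (1 - c) *\<^sub>R t)"
    if c: "c \<in> {0..1}" for c s t
  proof -
    have "c *\<^sub>R s + (1 - c) *\<^sub>R t \<in> X" if "convex X" "s \<in> X" "t \<in> X" for X
      using that c by (auto intro: convexD)
    from this[OF \<open>convex K\<close>] this[OF \<open>convex L\<close>] show ?thesis
      using \<open>K \<subseteq> L\<close> by (auto simp: two_level_def)
  qed
  show ?thesis
    unfolding fuzzy_vectors_def mem_Collect_eq
  proof (intro conjI allI ballI)
    show "two_level K L t \<in> {0..1}" for t by (simp add: two_level_def)
    show "\<exists>t. two_level K L t = 1" using \<open>K \<noteq> {}\<close> by (auto simp: two_level_def)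
    show "compact (closure {t. two_level K L t > 0})" 
      unfolding supp using \<open>compact L\<close> by (simp add: compact_imp_closed)
    show "closed {t. \<alpha> \<le> two_level K L t}" if "\<alpha> \<in> {0..1}" for \<alpha>
      using cut[OF that] assms by (simp add: compact_imp_closed)
  qed (rule conv)
qed

text \<open>A pair of points of the upper (lower) sets of the summands witnesses the value \<open>1\<close> (at least
  \<open>1/2\<close>), and no other pair has a minimum that reaches it.\<close>

lemma two_level_add:
  fixes K L K' L' :: "(real ^ 'n) set"
  assumes "K \<subseteq> L" "K' \<subseteq> L'"
  shows "two_level K L \<oplus>\<^sub>F two_level K' L' =
    two_level {x + y |x y. x \<in> K \<and> y \<in> K'} {x + y |x y. x \<in> L \<and> y \<in> L'}"
    (is "?f = ?g")
proof (rule ext, rule antisym)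
  fix t
  have le1: "two_level K L x \<le> 1" for x by (auto simp: two_level_def)
  show "?f t \<le> ?g t"
  proof (rule ccontr)
    assume "\<not> ?thesis"
    then have "?g t < ?f t" by simp
    from fuzzy_add_approx[OF le1 this] obtain r s
      where rs: "t = r + s" "?g t < two_level K L r" "?g t < two_level K' L' s"
      by blast
    have "?g t = 1" if "r \<in> K" "s \<in> K'"
      using that rs(1) unfolding two_level_def by auto
    moreover have "?g t \<ge> 1/2" if "r \<in> L" "s \<in> L'"
      using that rs(1) unfolding two_level_def by auto
    moreover have "?g t \<ge> 0" unfolding two_level_def by simp
    ultimately show False using assms rs(2,3)
      by (auto simp: two_level_def[of K L] two_level_def[of K' L'] split: if_splits)
  qed
  show "?g t \<le> ?f t"
  proof -
    have ge: "min (two_level K L x) (two_level K' L' y) \<le> ?f t" if "t = x + y" for x y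
      using fuzzy_add_ge[of "two_level K L" x "two_level K' L'" y, OF le1] that by simp
    consider x y where "t = x + y" "x \<in> K" "y \<in> K'" "?g t = 1"
      | x y where "t = x + y" "x \<in> L" "y \<in> L'" "?g t = 1/2" | "?g t = 0"
    proof (cases "\<exists>x y. t = x + y \<and> x \<in> K \<and> y \<in> K'")
      case True
      then have "?g t = 1" by (simp add: two_level_def)
      with True that(1) show ?thesis by blast
    next
      case notK: False
      show ?thesis
      proof (cases "\<exists>x y. t = x + y \<and> x \<in> L \<and> y \<in> L'")
        case True
        with notK have "?g t = 1/2" by (simp add: two_level_def)
        with True that(2) show ?thesis by blast
      next
        case False
        with notK have "?g t = 0" by (simp add: two_level_def)
        with that(3) show ?thesis by blast
      qed
    qed
    then show ?thesis
    proof cases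
      case 1
      then show ?thesis using ge[of x y] by (simp add: two_level_def[of K L] two_level_def[of K' L'])
    next
      case 2
      then have "two_level K L x \<ge> 1/2" "two_level K' L' y \<ge> 1/2"
        by (simp_all add: two_level_def)
      then show ?thesis using ge[of x y] 2 by linarith
    next
      case 3
      have "two_level K L t \<ge> 0" "two_level K' L' 0 \<ge> 0"
        by (simp_all add: two_level_def)
      then show ?thesis using ge[of t 0] 3 by simp
    qed
  qed
qed

text \<open>Split the corner \<open>(1, \<dots>, 1)\<close> as \<open>r + s\<close> with \<open>s\<close> in the support of the symmetric summand. That support
  contains with \<open>s\<close> the vector of length \<open>norm s\<close> along each axis, so that \<open>r\<close> stays at distance
  \<open>norm s\<close> from every facet at this corner. This forces all coordinates of \<open>s\<close> to be at least \<open>norm s\<close>,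
  which is impossible for two coordinates at once unless \<open>s = 0\<close>. Then the corner itself lies in the
  support of the other summand, and adding a vector of positive length along an axis leaves the
  cube.\<close>

lemma skew_if_support_cube:
  fixes v :: "real ^ 'n \<Rightarrow> real"
  assumes v: "v \<in> fuzzy_vectors" and n: "CARD('n) \<noteq> 1"
    and supp: "\<And>t. v t > 0 \<longleftrightarrow> (\<forall>k. \<bar>t $ k\<bar> \<le> 1)"
  shows "skew_fuzzy_vector v"
  unfolding skew_fuzzy_vector_def
proof (intro conjI ballI impI)
  show "v \<in> fuzzy_vectors" by fact
  fix x w :: "real ^ 'n \<Rightarrow> real"
  assume x: "x \<in> fuzzy_vectors" and w: "w \<in> symmetric_fuzzy_vectors" and eq: "v = x \<oplus>\<^sub>F w"
  obtain i j :: 'n where ij: "i \<noteq> j"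
  proof -
    have False if "\<And>i j :: 'n. i = j"
    proof -
      have "(UNIV :: 'n set) = {undefined}" using that by auto
      then have "CARD('n) = card {undefined :: 'n}" by (rule arg_cong)
      then show False using n by simp
    qed
    then show ?thesis using that by blast
  qed
  have wf: "w \<in> fuzzy_vectors" and radial: "norm s = norm t \<Longrightarrow> w s = w t" for s t
    using w symmetric_iff_radial by blast+
  have inside: "(r + s) $ k \<le> 1" if "x r > 0" "w s > 0" for r s k
  proof -
    have "v (r + s) > 0"
      using fuzzy_add_ge[of x r w s] fuzzy_vector_range[OF x] that unfolding eq by (meson less_le_trans min_less_iff_conj)
    then have "\<bar>(r + s) $ k\<bar> \<le> 1" using supp by blast
    then show ?thesis by linarith
  qed
  \<comment> \<open>Rotating the symmetric summand turns its radius towards any coordinate direction.\<close>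
  have pushed: "r $ k + norm s \<le> 1" if "x r > 0" "w s > 0" for r s k
  proof -
    have "w (norm s *\<^sub>R axis k 1) > 0"
      using radial[of "norm s *\<^sub>R axis k 1" s] that by simp
    from inside[OF \<open>x r > 0\<close> this, of k] show ?thesis by simp
  qed
  have "v (vec 1) > 0" using supp by simp
  then obtain r s where rs: "r + s = vec 1" "0 < x r" "0 < w s"
    using fuzzy_add_approx[of x 0 w "vec 1"] fuzzy_vector_range[OF x] eq by metis
  have coord: "norm s \<le> s $ k" for k
    using pushed[OF rs(2,3), of k] arg_cong[OF rs(1), of "\<lambda>z. z $ k"] by simp
  \<comment> \<open>Two coordinates of \<open>s\<close> are at least its norm, so \<open>s\<close> vanishes.\<close>
  have "s = 0"
  proof (rule ccontr)
    assume "s \<noteq> 0"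
    then have pos: "norm s > 0" by simp
    have "(s $ i)\<^sup>2 + (s $ j)\<^sup>2 \<le> (\<Sum>k\<in>UNIV. (s $ k)\<^sup>2)"
      using sum_mono2[of UNIV "{i, j}" "\<lambda>k. (s $ k)\<^sup>2"] ij by simp
    also have "\<dots> = (norm s)\<^sup>2"
      by (simp add: norm_vec_def L2_set_def sum_nonneg)
    finally have "(s $ i)\<^sup>2 + (s $ j)\<^sup>2 \<le> (norm s)\<^sup>2" .
    moreover have "(norm s)\<^sup>2 \<le> (s $ i)\<^sup>2" "(norm s)\<^sup>2 \<le> (s $ j)\<^sup>2"
      using coord pos by (auto intro!: power_mono)
    moreover have "(norm s)\<^sup>2 > 0" using pos by simp
    ultimately show False by linarith
  qed
  then have "r = vec 1" using rs by simp
  have off: "w t = 0" if "t \<noteq> 0" for t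
  proof (rule ccontr)
    assume "w t \<noteq> 0"
    then have "w t > 0" using fuzzy_vector_range[OF wf, of t] by simp
    from pushed[OF rs(2) this, of i] \<open>r = vec 1\<close> that show False by simp
  qed
  moreover have "w 0 = 1"
  proof -
    obtain t where "w t = 1" using wf unfolding fuzzy_vectors_def by blast
    with off[of t] show ?thesis by (cases "t = 0") auto
  qed
  ultimately show "w = fuzzy_origin"
    by (auto simp: fuzzy_origin_def)
qed

text \<open>The two decompositions assign the unit ball in the lower cut of the sum to different levels of
  the symmetric summand.\<close>

lemma two_cores:
  assumes n: "CARD('n::finite) \<noteq> 1"
  obtains u v v' :: "real ^ 'n \<Rightarrow> real"
  where "u \<in> fuzzy_vectors" "mares_core v u" "mares_core v' u" "v \<noteq> v'"
proof -
  define B where "B = cball (0 :: real ^ 'n) 1"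
  define C where "C = cbox (vec (-1)) (vec 1 :: real ^ 'n)"
  have mem_C: "x \<in> C \<longleftrightarrow> (\<forall>k. \<bar>x $ k\<bar> \<le> 1)" for x
  proof -
    have "-1 \<le> y \<and> y \<le> 1 \<longleftrightarrow> \<bar>y\<bar> \<le> 1" for y :: real by auto
    then show ?thesis unfolding C_def mem_box_cart vec_component by simp
  qed
  have "B \<subseteq> C"
  proof
    fix x assume "x \<in> B"
    then show "x \<in> C"
      unfolding mem_C unfolding B_def mem_cball_0
      using component_le_norm_cart[of x] by (blast intro: order_trans)
  qed
  have B: "compact B" "convex B" "{0} \<subseteq> B" "B \<noteq> {}"
    by (auto simp: B_def)
  have C: "compact C" "convex C" "{0} \<subseteq> C"
    using \<open>B \<subseteq> C\<close> B(3) by (auto simp: C_def)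
  let ?v = "two_level {0} C" and ?w = "two_level B B"
  let ?v' = "two_level B C" and ?w' = "two_level {0} B"
  let ?S = "{x + y |x y. x \<in> C \<and> y \<in> B}"
  have sum1: "?v \<oplus>\<^sub>F ?w = two_level B ?S" and sum2: "?v' \<oplus>\<^sub>F ?w' = two_level B ?S"
    using B C \<open>B \<subseteq> C\<close> by (simp_all add: two_level_add)
  have "B \<subseteq> ?S"
    using C(3) by force
  moreover have "compact ?S" using compact_sums[OF C(1) B(1)] .
  moreover have "convex ?S"
  proof -
    have "?S = (\<Union>x\<in>C. \<Union>y\<in>B. {x + y})" by auto
    then show ?thesis using convex_sums[OF C(2) B(2)] by simp
  qed
  ultimately have u: "two_level B ?S \<in> fuzzy_vectors"
    using B by (intro two_level_fuzzy_vector)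
  have fv: "?v \<in> fuzzy_vectors" "?v' \<in> fuzzy_vectors" "?w \<in> fuzzy_vectors" "?w' \<in> fuzzy_vectors"
    using B C \<open>B \<subseteq> C\<close> by (auto intro!: two_level_fuzzy_vector)
  have sym: "?w \<in> symmetric_fuzzy_vectors" "?w' \<in> symmetric_fuzzy_vectors"
    unfolding symmetric_iff_radial using fv by (auto simp: two_level_def B_def)
  have "?v t > 0 \<longleftrightarrow> t \<in> C" "?v' t > 0 \<longleftrightarrow> t \<in> C" for t
    using \<open>B \<subseteq> C\<close> C(3) by (auto simp: two_level_def)
  then have skew: "skew_fuzzy_vector ?v" "skew_fuzzy_vector ?v'"
    using skew_if_support_cube fv(1,2) n unfolding mem_C by blast+
  obtain e :: "real ^ 'n" where "norm e = 1" using vector_choose_size[of 1] by auto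
  then have "?v e \<noteq> ?v' e" by (auto simp: two_level_def B_def)
  then have "?v \<noteq> ?v'" by metis
  moreover have "mares_core ?v (two_level B ?S)" "mares_core ?v' (two_level B ?S)"
    unfolding mares_core_def using fv skew sum1[symmetric] sum2[symmetric] sym by blast+
  ultimately show ?thesis using u that by blast
qed

section \<open>Fuzzy vectors whose cuts are cubes\<close>

text \<open>The cut at level \<open>0\<close> is the whole space and carries no information, hence all conditions concern
  \<open>0 < \<alpha> \<le> 1\<close>. Left continuity expresses that the cut at \<open>\<alpha>\<close> is the intersection of the cuts below it,
  as it is for any family of superlevel sets; the bound corresponds to compact support.\<close>

locale endpoints =
  fixes a b :: "real \<Rightarrow> real"
  assumes mono: "\<lbrakk>0 < \<alpha>; \<alpha> \<le> \<beta>; \<beta> \<le> 1\<rbrakk> \<Longrightarrow> a \<alpha> \<le> a \<beta> \<and> b \<beta> \<le> b \<alpha>"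
    and top: "a 1 \<le> b 1"
    and left_cont: "\<lbrakk>0 < \<alpha>; \<alpha> \<le> 1; 0 < e\<rbrakk> \<Longrightarrow>
      \<exists>\<beta>. 0 < \<beta> \<and> \<beta> < \<alpha> \<and> a \<alpha> - e < a \<beta> \<and> b \<beta> < b \<alpha> + e"
    and bounded: "\<exists>B. \<forall>\<alpha>. 0 < \<alpha> \<and> \<alpha> \<le> 1 \<longrightarrow> - B \<le> a \<alpha> \<and> b \<alpha> \<le> B"
begin

lemma ordered: "0 < \<alpha> \<Longrightarrow> \<alpha> \<le> 1 \<Longrightarrow> a \<alpha> \<le> b \<alpha>"
  using mono[of \<alpha> 1] top by linarith

lemma between_limit:
  assumes "0 < \<alpha>" "\<alpha> \<le> 1" and x: "\<And>\<beta>. \<lbrakk>0 < \<beta>; \<beta> < \<alpha>\<rbrakk> \<Longrightarrow> a \<beta> \<le> x \<and> x \<le> b \<beta>"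
  shows "a \<alpha> \<le> x \<and> x \<le> b \<alpha>"
proof (rule ccontr)
  assume neg: "\<not> ?thesis"
  define e where "e = max (a \<alpha> - x) (x - b \<alpha>)"
  have "e > 0" using neg by (auto simp: e_def)
  obtain \<beta> where \<beta>: "0 < \<beta>" "\<beta> < \<alpha>" "a \<alpha> - e < a \<beta>" "b \<beta> < b \<alpha> + e"
    using left_cont[OF assms(1,2) \<open>e > 0\<close>] by blast
  with x[of \<beta>] have "a \<alpha> - x < e" "x - b \<alpha> < e" by auto
  then show False by (simp add: e_def)
qed

end

lemma endpoints_add:
  assumes "endpoints a b" "endpoints c d"
  shows "endpoints (\<lambda>\<alpha>. a \<alpha> + c \<alpha>) (\<lambda>\<alpha>. b \<alpha> + d \<alpha>)"
proof -
  interpret ab: endpoints a b by fact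
  interpret cd: endpoints c d by fact
  show ?thesis
  proof
    show "a \<alpha> + c \<alpha> \<le> a \<beta> + c \<beta> \<and> b \<beta> + d \<beta> \<le> b \<alpha> + d \<alpha>"
      if "0 < \<alpha>" "\<alpha> \<le> \<beta>" "\<beta> \<le> 1" for \<alpha> \<beta>
      using ab.mono[OF that] cd.mono[OF that] by linarith
    show "a 1 + c 1 \<le> b 1 + d 1"
      using ab.top cd.top by linarith
    show "\<exists>\<beta>. 0 < \<beta> \<and> \<beta> < \<alpha> \<and> a \<alpha> + c \<alpha> - e < a \<beta> + c \<beta> \<and> b \<beta> + d \<beta> < b \<alpha> + d \<alpha> + e"
      if \<alpha>: "0 < \<alpha>" "\<alpha> \<le> 1" and e: "0 < e" for \<alpha> e
    proof -
      have e2: "0 < e / 2" using e by simp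
      obtain \<beta> where \<beta>: "0 < \<beta>" "\<beta> < \<alpha>" "a \<alpha> - e/2 < a \<beta>" "b \<beta> < b \<alpha> + e/2"
        using ab.left_cont[OF \<alpha> e2] by blast
      obtain \<gamma> where \<gamma>: "0 < \<gamma>" "\<gamma> < \<alpha>" "c \<alpha> - e/2 < c \<gamma>" "d \<gamma> < d \<alpha> + e/2"
        using cd.left_cont[OF \<alpha> e2] by blast
      have "a \<beta> \<le> a (max \<beta> \<gamma>) \<and> b (max \<beta> \<gamma>) \<le> b \<beta>"
        using \<beta> \<gamma> \<alpha> by (intro ab.mono) auto
      moreover have "c \<gamma> \<le> c (max \<beta> \<gamma>) \<and> d (max \<beta> \<gamma>) \<le> d \<gamma>"
        using \<beta> \<gamma> \<alpha> by (intro cd.mono) auto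
      ultimately have "a \<alpha> + c \<alpha> - e < a (max \<beta> \<gamma>) + c (max \<beta> \<gamma>)"
        "b (max \<beta> \<gamma>) + d (max \<beta> \<gamma>) < b \<alpha> + d \<alpha> + e"
        using \<beta> \<gamma> by linarith+
      then show ?thesis using \<beta> \<gamma> by (intro exI[of _ "max \<beta> \<gamma>"]) auto
    qed
    obtain B where B: "\<forall>\<alpha>. 0 < \<alpha> \<and> \<alpha> \<le> 1 \<longrightarrow> - B \<le> a \<alpha> \<and> b \<alpha> \<le> B" using ab.bounded by blast
    obtain B' where B': "\<forall>\<alpha>. 0 < \<alpha> \<and> \<alpha> \<le> 1 \<longrightarrow> - B' \<le> c \<alpha> \<and> d \<alpha> \<le> B'" using cd.bounded by blast
    have "- (B + B') \<le> a \<alpha> + c \<alpha> \<and> b \<alpha> + d \<alpha> \<le> B + B'" if "0 < \<alpha> \<and> \<alpha> \<le> 1" for \<alpha>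
      using B[rule_format, OF that] B'[rule_format, OF that] by linarith
    then show "\<exists>B. \<forall>\<alpha>. 0 < \<alpha> \<and> \<alpha> \<le> 1 \<longrightarrow> - B \<le> a \<alpha> + c \<alpha> \<and> b \<alpha> + d \<alpha> \<le> B" by blast
  qed
qed

text \<open>Cubes with equal sides in all coordinates specialise to intervals in dimension one, and they spare
  the choice of a coordinate there.\<close>

definition in_cube :: "real \<Rightarrow> real \<Rightarrow> real ^ 'n \<Rightarrow> bool" where
  "in_cube x y t \<longleftrightarrow> (\<forall>k. x \<le> t $ k \<and> t $ k \<le> y)"

definition has_cuts :: "(real ^ 'n \<Rightarrow> real) \<Rightarrow> (real \<Rightarrow> real) \<Rightarrow> (real \<Rightarrow> real) \<Rightarrow> bool" where
  "has_cuts u a b \<longleftrightarrow> endpoints a b \<and> (\<forall>t. 0 \<le> u t \<and> u t \<le> 1) \<and>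
     (\<forall>\<alpha> t. 0 < \<alpha> \<and> \<alpha> \<le> 1 \<longrightarrow> (\<alpha> \<le> u t \<longleftrightarrow> in_cube (a \<alpha>) (b \<alpha>) t))"

lemma in_cube_cbox: "{t. in_cube x y t} = cbox (vec x) (vec y)"
  unfolding in_cube_def set_eq_iff mem_box_cart by simp

lemma in_cube_vec: "in_cube x y (vec z) \<longleftrightarrow> x \<le> z \<and> z \<le> y"
  unfolding in_cube_def by simp

lemma has_cutsD:
  assumes "has_cuts u a b"
  shows "endpoints a b" "0 \<le> u t" "u t \<le> 1"
    "0 < \<alpha> \<Longrightarrow> \<alpha> \<le> 1 \<Longrightarrow> \<alpha> \<le> u t \<longleftrightarrow> in_cube (a \<alpha>) (b \<alpha>) t"
  using assms unfolding has_cuts_def by blast+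

lemma has_cuts_le:
  assumes u: "has_cuts u a b" and v: "has_cuts v c d"
    and sub: "\<And>\<alpha>. \<lbrakk>0 < \<alpha>; \<alpha> \<le> 1; in_cube (a \<alpha>) (b \<alpha>) s\<rbrakk> \<Longrightarrow> in_cube (c \<alpha>) (d \<alpha>) t"
  shows "u s \<le> v t"
proof (cases "u s \<le> 0")
  case True
  then show ?thesis using has_cutsD(2)[OF v, of t] by linarith
next
  case False
  then have \<alpha>: "0 < u s" "u s \<le> 1" using has_cutsD(3)[OF u] by simp_all
  then have "in_cube (a (u s)) (b (u s)) s" using has_cutsD(4)[OF u \<alpha>, of s] by simp
  with sub[OF \<alpha>] show ?thesis using has_cutsD(4)[OF v \<alpha>] by blast
qed

lemma has_cuts_determines_vector:
  assumes "has_cuts u a b" "has_cuts v c d"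
    and "\<And>\<alpha>. \<lbrakk>0 < \<alpha>; \<alpha> \<le> 1\<rbrakk> \<Longrightarrow> a \<alpha> = c \<alpha> \<and> b \<alpha> = d \<alpha>"
  shows "u = v"
proof
  fix t
  have "u t \<le> v t"
    by (rule has_cuts_le[OF assms(1,2)]) (simp add: assms(3))
  moreover have "v t \<le> u t"
    by (rule has_cuts_le[OF assms(2,1)]) (simp add: assms(3))
  ultimately show "u t = v t" by simp
qed

lemma has_cuts_determines_endpoints:
  fixes u :: "real ^ 'n \<Rightarrow> real"
  assumes u: "has_cuts u a b" "has_cuts u c d" and \<alpha>: "0 < \<alpha>" "\<alpha> \<le> 1"
  shows "a \<alpha> = c \<alpha> \<and> b \<alpha> = d \<alpha>"
proof -
  have le: "c \<alpha> \<le> a \<alpha> \<and> b \<alpha> \<le> d \<alpha>" if u: "has_cuts u a b" "has_cuts u c d" for a b c d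
  proof -
    have eq: "in_cube (a \<alpha>) (b \<alpha>) t \<longleftrightarrow> in_cube (c \<alpha>) (d \<alpha>) t" for t :: "real ^ 'n"
      using has_cutsD(4)[OF u(1) \<alpha>] has_cutsD(4)[OF u(2) \<alpha>] by blast
    show ?thesis
      using eq[of "vec (a \<alpha>)"] eq[of "vec (b \<alpha>)"] endpoints.ordered[OF has_cutsD(1)[OF u(1)] \<alpha>]
      unfolding in_cube_vec by linarith
  qed
  show ?thesis using le[OF u] le[OF u(2,1)] by linarith
qed

lemma has_cuts_imp_fuzzy_vector:
  fixes u :: "real ^ 'n \<Rightarrow> real"
  assumes u: "has_cuts u a b"
  shows "u \<in> fuzzy_vectors"
proof -
  interpret endpoints a b using has_cutsD(1)[OF u] .
  have cut: "{t. \<alpha> \<le> u t} = cbox (vec (a \<alpha>)) (vec (b \<alpha>))" if "0 < \<alpha>" "\<alpha> \<le> 1" for \<alpha>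
    using has_cutsD(4)[OF u that] in_cube_cbox by blast
  obtain B where B: "\<forall>\<alpha>. 0 < \<alpha> \<and> \<alpha> \<le> 1 \<longrightarrow> - B \<le> a \<alpha> \<and> b \<alpha> \<le> B" using bounded by blast
  have "t \<in> cbox (vec (- B)) (vec B)" if "u t > 0" for t
  proof -
    have "in_cube (a (u t)) (b (u t)) t" using has_cutsD(4)[OF u that has_cutsD(3)[OF u], of t] by simp
    then have "in_cube (- B) B t"
      using B[rule_format, of "u t"] that has_cutsD(3)[OF u, of t] unfolding in_cube_def
      by (meson order_trans)
    then show ?thesis using in_cube_cbox by blast
  qed
  then have "bounded {t. u t > 0}" by (intro bounded_subset[OF bounded_cbox]) blast
  then have "compact (closure {t. u t > 0})" by simp
  moreover have "u (vec (a 1)) = 1"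
    using has_cutsD(4)[OF u, of 1 "vec (a 1)"] has_cutsD(3)[OF u, of "vec (a 1)"] top
    by (simp add: in_cube_vec)
  moreover have "min (u s) (u t) \<le> u (c *\<^sub>R s + (1 - c) *\<^sub>R t)" if c: "c \<in> {0..1}" for s t c
  proof (cases "min (u s) (u t) \<le> 0")
    case True
    then show ?thesis using has_cutsD(2)[OF u] by (meson order_trans)
  next
    case False
    have "s \<in> {x. min (u s) (u t) \<le> u x}" "t \<in> {x. min (u s) (u t) \<le> u x}" by simp_all
    moreover have "convex {x. min (u s) (u t) \<le> u x}"
      using False has_cutsD(3)[OF u, of s] by (subst cut) auto
    ultimately have "c *\<^sub>R s + (1 - c) *\<^sub>R t \<in> {x. min (u s) (u t) \<le> u x}"
      using c by (intro convexD) auto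
    then show ?thesis by simp
  qed
  moreover have "closed {t. \<alpha> \<le> u t}" if "\<alpha> \<in> {0..1}" for \<alpha>
  proof (cases "\<alpha> = 0")
    case True
    then show ?thesis using has_cutsD(2)[OF u] by simp
  next
    case False
    then show ?thesis using that cut[of \<alpha>] by (simp add: closed_cbox)
  qed
  ultimately show ?thesis
    using has_cutsD(2,3)[OF u] unfolding fuzzy_vectors_def by (auto simp del: closure_closed)
qed

text \<open>The vector is \<open>t \<mapsto> Sup {\<alpha>. t lies in the cut at \<alpha>}\<close>. Left continuity makes its superlevel sets
  the prescribed cubes and not larger ones.\<close>

lemma has_cuts_exists:
  assumes ep: "endpoints a b"
  obtains u :: "real ^ 'n \<Rightarrow> real" where "has_cuts u a b"
proof -
  interpret endpoints a b by fact
  define S where "S t = insert 0 {\<alpha>. 0 < \<alpha> \<and> \<alpha> \<le> 1 \<and> in_cube (a \<alpha>) (b \<alpha>) t}" for t :: "real ^ 'n"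
  have S: "S t \<noteq> {}" "bdd_above (S t)" "0 \<in> S t" for t
    by (auto simp: S_def intro!: bdd_aboveI[of _ 1])
  have "\<alpha> \<le> Sup (S t) \<longleftrightarrow> in_cube (a \<alpha>) (b \<alpha>) t" if \<alpha>: "0 < \<alpha>" "\<alpha> \<le> 1" for \<alpha> t
  proof
    assume "in_cube (a \<alpha>) (b \<alpha>) t"
    then show "\<alpha> \<le> Sup (S t)" using \<alpha> S(2) by (intro cSup_upper) (auto simp: S_def)
  next
    assume le: "\<alpha> \<le> Sup (S t)"
    have "in_cube (a \<beta>) (b \<beta>) t" if \<beta>: "0 < \<beta>" "\<beta> < \<alpha>" for \<beta>
    proof -
      have "\<beta> < Sup (S t)" using le \<beta> by linarith
      then obtain \<gamma> where \<gamma>: "\<gamma> \<in> S t" "\<beta> < \<gamma>" using less_cSup_iff[OF S(1,2)] by blast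
      then have "0 < \<gamma>" "\<gamma> \<le> 1" "in_cube (a \<gamma>) (b \<gamma>) t" using \<beta> by (auto simp: S_def)
      moreover have "a \<beta> \<le> a \<gamma> \<and> b \<gamma> \<le> b \<beta>" using \<beta> \<gamma> calculation by (intro mono) auto
      ultimately show ?thesis unfolding in_cube_def by (meson order_trans)
    qed
    then show "in_cube (a \<alpha>) (b \<alpha>) t"
      unfolding in_cube_def using between_limit[OF \<alpha>] by blast
  qed
  moreover have "0 \<le> Sup (S t)" for t
    using S by (intro cSup_upper) auto
  moreover have "Sup (S t) \<le> 1" for t
    using S(1) by (intro cSup_least) (auto simp: S_def)
  ultimately have "has_cuts (\<lambda>t. Sup (S t)) a b"
    unfolding has_cuts_def using ep by blast
  then show ?thesis using that by blast
qed

text \<open>If the sum is at least \<open>\<alpha>\<close> at \<open>t\<close>, then \<open>t\<close> lies in the sum of the cuts at every level below \<open>\<alpha>\<close>,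
  and left continuity passes to \<open>\<alpha>\<close> itself.\<close>

lemma has_cuts_add:
  fixes u v :: "real ^ 'n \<Rightarrow> real"
  assumes u: "has_cuts u a b" and v: "has_cuts v c d"
  shows "has_cuts (u \<oplus>\<^sub>F v) (\<lambda>\<alpha>. a \<alpha> + c \<alpha>) (\<lambda>\<alpha>. b \<alpha> + d \<alpha>)"
  unfolding has_cuts_def
proof (intro conjI allI impI iffI; (elim conjE)?)
  show ep: "endpoints (\<lambda>\<alpha>. a \<alpha> + c \<alpha>) (\<lambda>\<alpha>. b \<alpha> + d \<alpha>)"
    using endpoints_add has_cutsD(1) u v by blast
  show "0 \<le> (u \<oplus>\<^sub>F v) t" "(u \<oplus>\<^sub>F v) t \<le> 1" for t
    using fuzzy_add_range has_cutsD(2,3)[OF u] has_cutsD(2,3)[OF v] by blast+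
  fix \<alpha> :: real and t :: "real ^ 'n"
  assume \<alpha>: "0 < \<alpha>" "\<alpha> \<le> 1"
  show "in_cube (a \<alpha> + c \<alpha>) (b \<alpha> + d \<alpha>) t" if le: "\<alpha> \<le> (u \<oplus>\<^sub>F v) t"
  proof -
    have "in_cube (a \<beta> + c \<beta>) (b \<beta> + d \<beta>) t" if \<beta>: "0 < \<beta>" "\<beta> < \<alpha>" for \<beta>
    proof -
      have "\<beta> < (u \<oplus>\<^sub>F v) t" using le \<beta> by linarith
      from fuzzy_add_approx[OF has_cutsD(3)[OF u] this] obtain r s
        where rs: "r + s = t" "\<beta> < u r" "\<beta> < v s" by blast
      have \<beta>1: "\<beta> \<le> 1" using \<alpha> \<beta> by linarith
      have "in_cube (a \<beta>) (b \<beta>) r" "in_cube (c \<beta>) (d \<beta>) s"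
        using rs has_cutsD(4)[OF u \<beta>(1) \<beta>1, of r] has_cutsD(4)[OF v \<beta>(1) \<beta>1, of s] by simp_all
      then show ?thesis unfolding in_cube_def rs(1)[symmetric] vector_add_component
        by (meson add_mono)
    qed
    then show ?thesis
      unfolding in_cube_def using endpoints.between_limit[OF ep \<alpha>] by blast
  qed
  show "\<alpha> \<le> (u \<oplus>\<^sub>F v) t" if t: "in_cube (a \<alpha> + c \<alpha>) (b \<alpha> + d \<alpha>) t"
  proof -
    \<comment> \<open>Any value between \<open>max (a \<alpha>) (t $ k - d \<alpha>)\<close> and \<open>min (b \<alpha>) (t $ k - c \<alpha>)\<close> splits
      the coordinate.\<close>
    define r where "r = (\<chi> k. max (a \<alpha>) (t $ k - d \<alpha>))"
    have ord: "a \<alpha> \<le> b \<alpha>" "c \<alpha> \<le> d \<alpha>"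
      using endpoints.ordered[OF has_cutsD(1)[OF u] \<alpha>] endpoints.ordered[OF has_cutsD(1)[OF v] \<alpha>]
      by simp_all
    have tk: "a \<alpha> + c \<alpha> \<le> t $ k" "t $ k \<le> b \<alpha> + d \<alpha>" for k
      using t unfolding in_cube_def by simp_all
    have "in_cube (a \<alpha>) (b \<alpha>) r"
      unfolding in_cube_def r_def using ord tk by (simp add: diff_le_eq)
    moreover have "in_cube (c \<alpha>) (d \<alpha>) (t - r)"
      unfolding in_cube_def
    proof
      fix k
      show "c \<alpha> \<le> (t - r) $ k \<and> (t - r) $ k \<le> d \<alpha>"
        using ord tk[of k] unfolding r_def by (simp add: max_def)
    qed
    ultimately have "\<alpha> \<le> min (u r) (v (t - r))"
      using has_cutsD(4)[OF u \<alpha>] has_cutsD(4)[OF v \<alpha>] by simp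
    also have "\<dots> \<le> (u \<oplus>\<^sub>F v) (r + (t - r))"
      by (rule fuzzy_add_ge) (rule has_cutsD(3)[OF u])
    finally show ?thesis by simp
  qed
qed

text \<open>The vectors with all coordinates \<open>x\<close> and with all coordinates \<open>- x\<close> have the same norm.\<close>

lemma symmetric_has_cuts:
  fixes w :: "real ^ 'n \<Rightarrow> real"
  assumes w: "w \<in> symmetric_fuzzy_vectors" "has_cuts w a b" and \<alpha>: "0 < \<alpha>" "\<alpha> \<le> 1"
  shows "a \<alpha> = - b \<alpha>"
proof -
  have refl: "in_cube (a \<alpha>) (b \<alpha>) (vec (- x) :: real ^ 'n) \<longleftrightarrow> in_cube (a \<alpha>) (b \<alpha>) (vec x :: real ^ 'n)" for x
  proof -
    have "vec (- x) = - (vec x :: real ^ 'n)" by (simp add: vec_eq_iff)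
    then have "norm (vec (- x) :: real ^ 'n) = norm (vec x :: real ^ 'n)" by simp
    then have "w (vec (- x)) = w (vec x)" using w(1) unfolding symmetric_iff_radial by blast
    then show ?thesis using has_cutsD(4)[OF w(2) \<alpha>, of "vec x"] has_cutsD(4)[OF w(2) \<alpha>, of "vec (- x)"] by simp
  qed
  show ?thesis
    using refl[of "a \<alpha>"] refl[of "b \<alpha>"] endpoints.ordered[OF has_cutsD(1)[OF w(2)] \<alpha>]
    unfolding in_cube_vec by linarith
qed

lemma fuzzy_origin_has_cuts: "has_cuts fuzzy_origin (\<lambda>_. 0) (\<lambda>_. 0)"
proof -
  have "endpoints (\<lambda>_. 0) (\<lambda>_. 0)"
  proof
    show "\<exists>\<beta>. 0 < \<beta> \<and> \<beta> < \<alpha> \<and> 0 - e < (0::real) \<and> (0::real) < 0 + e" if "0 < \<alpha>" "0 < e" for \<alpha> e :: real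
      using that by (intro exI[of _ "\<alpha>/2"]) auto
    show "\<exists>B. \<forall>\<alpha>::real. 0 < \<alpha> \<and> \<alpha> \<le> 1 \<longrightarrow> - B \<le> (0::real) \<and> (0::real) \<le> B"
      by (intro exI[of _ 0]) simp
  qed simp_all
  moreover have "in_cube 0 0 t \<longleftrightarrow> t = 0" for t :: "real ^ 'a"
    by (auto simp: in_cube_def vec_eq_iff intro: antisym)
  ultimately show ?thesis
    unfolding has_cuts_def by (auto simp: fuzzy_origin_def)
qed

section \<open>Dimension one\<close>

lemma norm_one_dimensional:
  fixes t :: "real ^ 'n"
  assumes n: "CARD('n) = 1"
  shows "norm t = \<bar>t $ k\<bar>"
proof -
  have "UNIV = {k}" using n by (metis UNIV_I card_1_singletonE singletonD)
  then have "(\<Sum>i\<in>UNIV. (t $ i)\<^sup>2) = (\<Sum>i\<in>{k}. (t $ i)\<^sup>2)" by (rule arg_cong)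
  then show ?thesis by (simp add: norm_vec_def L2_set_def)
qed

text \<open>Each cut is compact, convex and nonempty, hence a compact interval. Left continuity holds because
  a point that lies in all lower cuts has membership value at least \<open>\<alpha>\<close>.\<close>

lemma fuzzy_vector_has_cuts:
  fixes u :: "real ^ 'n \<Rightarrow> real"
  assumes n: "CARD('n) = 1" and u: "u \<in> fuzzy_vectors"
  obtains a b where "has_cuts u a b"
proof -
  obtain k :: 'n where k: "UNIV = {k}" using n card_1_singletonE by blast
  then have all_k: "(\<forall>j. P j) \<longleftrightarrow> P k" for P by (metis UNIV_I singletonD)
  have eq_k: "s = t \<longleftrightarrow> s $ k = t $ k" for s t :: "real ^ 'n"
    unfolding vec_eq_iff by (rule all_k)
  obtain t\<^sub>0 where t0: "u t\<^sub>0 = 1" using u unfolding fuzzy_vectors_def by blast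
  have comp: "compact (closure {t. u t > 0})"
    and conv: "\<And>s t c. c \<in> {0..1} \<Longrightarrow> min (u s) (u t) \<le> u (c *\<^sub>R s + (1 - c) *\<^sub>R t)"
    and clos: "\<And>\<alpha>. \<alpha> \<in> {0..1} \<Longrightarrow> closed {t. \<alpha> \<le> u t}"
    using u unfolding fuzzy_vectors_def by blast+
  have "\<exists>x y. (\<lambda>t. t $ k) ` {t. \<alpha> \<le> u t} = {x..y}" if \<alpha>: "0 < \<alpha>" "\<alpha> \<le> 1" for \<alpha>
  proof -
    have "{t. \<alpha> \<le> u t} \<subseteq> closure {t. u t > 0}"
      using \<alpha> closure_subset[of "{t. u t > 0}"] by force
    then have "compact {t. \<alpha> \<le> u t}"
      using compact_Int_closed[OF comp clos[of \<alpha>]] \<alpha> by (simp add: Int_absorb1)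
    moreover have "convex {t. \<alpha> \<le> u t}"
    proof (rule convexI)
      fix s t and p q :: real
      assume *: "s \<in> {t. \<alpha> \<le> u t}" "t \<in> {t. \<alpha> \<le> u t}" "0 \<le> p" "0 \<le> q" "p + q = 1"
      then have "q = 1 - p" "p \<in> {0..1}" by auto
      then show "p *\<^sub>R s + q *\<^sub>R t \<in> {t. \<alpha> \<le> u t}"
        using *(1,2) conv[OF \<open>p \<in> {0..1}\<close>, of s t] by simp
    qed
    then have "connected {t. \<alpha> \<le> u t}" by (rule convex_connected)
    moreover have "continuous_on {t. \<alpha> \<le> u t} (\<lambda>t. t $ k)" by (intro continuous_intros)
    ultimately show ?thesis
      using compact_continuous_image connected_continuous_image connected_compact_interval_1 by blast
  qed
  then obtain a b where ab: "\<And>\<alpha>. \<lbrakk>0 < \<alpha>; \<alpha> \<le> 1\<rbrakk> \<Longrightarrow> (\<lambda>t. t $ k) ` {t. \<alpha> \<le> u t} = {a \<alpha>..b \<alpha>}"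
    by metis
  have cut: "\<alpha> \<le> u t \<longleftrightarrow> a \<alpha> \<le> t $ k \<and> t $ k \<le> b \<alpha>" if \<alpha>: "0 < \<alpha>" "\<alpha> \<le> 1" for \<alpha> t
  proof -
    have "\<alpha> \<le> u t \<longleftrightarrow> t $ k \<in> (\<lambda>t. t $ k) ` {t. \<alpha> \<le> u t}"
    proof
      assume "t $ k \<in> (\<lambda>t. t $ k) ` {t. \<alpha> \<le> u t}"
      then obtain s where "\<alpha> \<le> u s" "t $ k = s $ k" by blast
      then show "\<alpha> \<le> u t" using eq_k by metis
    qed simp
    then show ?thesis unfolding ab[OF \<alpha>] by simp
  qed
  have ord: "a \<alpha> \<le> b \<alpha>" if "0 < \<alpha>" "\<alpha> \<le> 1" for \<alpha>
    using cut[OF that, of t\<^sub>0] t0 that by linarith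
  have mono: "a \<alpha> \<le> a \<beta> \<and> b \<beta> \<le> b \<alpha>" if "0 < \<alpha>" "\<alpha> \<le> \<beta>" "\<beta> \<le> 1" for \<alpha> \<beta>
  proof -
    have "a \<beta> \<le> b \<beta>" using ord that by simp
    have "\<beta> \<le> u (vec (a \<beta>))" "\<beta> \<le> u (vec (b \<beta>))"
      using cut[of \<beta> "vec (a \<beta>)"] cut[of \<beta> "vec (b \<beta>)"] that \<open>a \<beta> \<le> b \<beta>\<close> by simp_all
    then show ?thesis
      using cut[of \<alpha> "vec (a \<beta>)"] cut[of \<alpha> "vec (b \<beta>)"] that by simp
  qed
  have inside: "a \<alpha> \<le> x \<and> x \<le> b \<alpha>"
    if \<alpha>: "0 < \<alpha>" "\<alpha> \<le> 1" and x: "\<And>\<beta>. \<lbrakk>0 < \<beta>; \<beta> < \<alpha>\<rbrakk> \<Longrightarrow> a \<beta> \<le> x \<and> x \<le> b \<beta>" for \<alpha> x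
  proof -
    have "\<beta> \<le> u (vec x)" if "0 < \<beta>" "\<beta> < \<alpha>" for \<beta>
      using cut[of \<beta> "vec x"] x[OF that] that \<alpha> by simp
    then have "\<alpha> \<le> u (vec x)" using \<alpha>(1) by (rule dense_le_bounded[rotated])
    then show ?thesis using cut[OF \<alpha>] by simp
  qed
  have left_a: "\<exists>\<beta>. 0 < \<beta> \<and> \<beta> < \<alpha> \<and> a \<alpha> - e < a \<beta>" if \<alpha>: "0 < \<alpha>" "\<alpha> \<le> 1" and e: "0 < e" for \<alpha> e
  proof (rule ccontr)
    assume neg: "\<not> ?thesis"
    have "a \<beta> \<le> a \<alpha> - e \<and> a \<alpha> - e \<le> b \<beta>" if \<beta>: "0 < \<beta>" "\<beta> < \<alpha>" for \<beta>
    proof -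
      have "a \<beta> \<le> a \<alpha> - e" using neg \<beta> by force
      moreover have "b \<alpha> \<le> b \<beta>" using mono[of \<beta> \<alpha>] \<beta> \<alpha> by simp
      ultimately show ?thesis using ord[OF \<alpha>] e by linarith
    qed
    then have "a \<alpha> \<le> a \<alpha> - e" using inside[OF \<alpha>] by blast
    then show False using e by simp
  qed
  have left_b: "\<exists>\<beta>. 0 < \<beta> \<and> \<beta> < \<alpha> \<and> b \<beta> < b \<alpha> + e" if \<alpha>: "0 < \<alpha>" "\<alpha> \<le> 1" and e: "0 < e" for \<alpha> e
  proof (rule ccontr)
    assume neg: "\<not> ?thesis"
    have "a \<beta> \<le> b \<alpha> + e \<and> b \<alpha> + e \<le> b \<beta>" if \<beta>: "0 < \<beta>" "\<beta> < \<alpha>" for \<beta>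
    proof -
      have "b \<alpha> + e \<le> b \<beta>" using neg \<beta> by force
      moreover have "a \<beta> \<le> a \<alpha>" using mono[of \<beta> \<alpha>] \<beta> \<alpha> by simp
      ultimately show ?thesis using ord[OF \<alpha>] e by linarith
    qed
    then have "b \<alpha> + e \<le> b \<alpha>" using inside[OF \<alpha>] by blast
    then show False using e by simp
  qed
  have "endpoints a b"
  proof
    show "a \<alpha> \<le> a \<beta> \<and> b \<beta> \<le> b \<alpha>" if "0 < \<alpha>" "\<alpha> \<le> \<beta>" "\<beta> \<le> 1" for \<alpha> \<beta>
      using mono[OF that] .
    show "a 1 \<le> b 1" using ord[of 1] by simp
    show "\<exists>\<beta>. 0 < \<beta> \<and> \<beta> < \<alpha> \<and> a \<alpha> - e < a \<beta> \<and> b \<beta> < b \<alpha> + e"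
      if \<alpha>: "0 < \<alpha>" "\<alpha> \<le> 1" and e: "0 < e" for \<alpha> e
    proof -
      obtain \<beta> where \<beta>: "0 < \<beta>" "\<beta> < \<alpha>" "a \<alpha> - e < a \<beta>" using left_a[OF \<alpha> e] by blast
      obtain \<gamma> where \<gamma>: "0 < \<gamma>" "\<gamma> < \<alpha>" "b \<gamma> < b \<alpha> + e" using left_b[OF \<alpha> e] by blast
      have "a \<beta> \<le> a (max \<beta> \<gamma>)" using \<beta> \<gamma> \<alpha> mono[of \<beta> "max \<beta> \<gamma>"] by simp
      moreover have "b (max \<beta> \<gamma>) \<le> b \<gamma>" using \<beta> \<gamma> \<alpha> mono[of \<gamma> "max \<beta> \<gamma>"] by simp
      ultimately show ?thesis using \<beta> \<gamma> by (intro exI[of _ "max \<beta> \<gamma>"]) auto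
    qed
    obtain B where B: "\<And>t. t \<in> closure {t. u t > 0} \<Longrightarrow> norm t \<le> B"
      using compact_imp_bounded[OF comp] unfolding bounded_iff by blast
    have bound: "\<bar>x\<bar> \<le> B" if "0 < \<alpha>" "\<alpha> \<le> 1" "a \<alpha> \<le> x" "x \<le> b \<alpha>" for \<alpha> x
    proof -
      have "\<alpha> \<le> u (vec x)" using cut[of \<alpha> "vec x"] that by simp
      then have "vec x \<in> {t. u t > 0}" using that by simp
      then have "norm (vec x :: real ^ 'n) \<le> B" by (rule B[OF subsetD[OF closure_subset]])
      then show ?thesis by (simp add: norm_one_dimensional[OF n, of _ k])
    qed
    have "- B \<le> a \<alpha> \<and> b \<alpha> \<le> B" if "0 < \<alpha> \<and> \<alpha> \<le> 1" for \<alpha>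
      using bound[of \<alpha> "a \<alpha>"] bound[of \<alpha> "b \<alpha>"] ord[of \<alpha>] that by linarith
    then show "\<exists>B. \<forall>\<alpha>. 0 < \<alpha> \<and> \<alpha> \<le> 1 \<longrightarrow> - B \<le> a \<alpha> \<and> b \<alpha> \<le> B" by blast
  qed
  moreover have "in_cube x y t \<longleftrightarrow> x \<le> t $ k \<and> t $ k \<le> y" for x y and t :: "real ^ 'n"
    unfolding in_cube_def by (rule all_k)
  ultimately have "has_cuts u a b"
    unfolding has_cuts_def using cut fuzzy_vector_range[OF u] by simp
  then show ?thesis using that by blast
qed

lemma centred_cuts_imp_symmetric:
  fixes w :: "real ^ 'n \<Rightarrow> real"
  assumes n: "CARD('n) = 1" and w: "has_cuts w (\<lambda>\<alpha>. - r \<alpha>) r"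
  shows "w \<in> symmetric_fuzzy_vectors"
  unfolding symmetric_iff_radial
proof (intro conjI allI impI)
  show "w \<in> fuzzy_vectors" using has_cuts_imp_fuzzy_vector[OF w] .
  have le: "w s \<le> w t" if st: "norm s = norm t" for s t
  proof (rule has_cuts_le[OF w w])
    fix \<alpha> assume "in_cube (- r \<alpha>) (r \<alpha>) s"
    moreover have "\<bar>s $ k\<bar> = \<bar>t $ k\<bar>" for k
      using st norm_one_dimensional[OF n] by metis
    ultimately show "in_cube (- r \<alpha>) (r \<alpha>) t"
      unfolding in_cube_def by (smt (verit))
  qed
  show "w s = w t" if "norm s = norm t" for s t
    using le[OF that] le[OF that[symmetric]] by simp
qed

section \<open>The variation of the midpoint\<close>

definition dominates_increments :: "(real \<Rightarrow> real) \<Rightarrow> (real \<Rightarrow> real) \<Rightarrow> real \<Rightarrow> bool" where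
  "dominates_increments g m \<alpha> \<longleftrightarrow>
     (\<forall>x y. \<alpha> \<le> x \<and> x \<le> y \<and> y \<le> 1 \<longrightarrow> \<bar>m x - m y\<bar> \<le> g x - g y)"

text \<open>For \<open>m\<close> of bounded variation this is the total variation on \<open>[\<alpha>, 1]\<close>. Describing it as the least
  total decrease of a function that dominates all increments, instead of a supremum over partitions,
  makes its minimality immediate and reduces its additivity to gluing two dominating functions.\<close>

definition variation_to_top :: "(real \<Rightarrow> real) \<Rightarrow> real \<Rightarrow> real" where
  "variation_to_top m \<alpha> = Inf {g \<alpha> - g 1 |g. dominates_increments g m \<alpha>}"

lemma dominates_incrementsD:
  "\<lbrakk>dominates_increments g m \<alpha>; \<alpha> \<le> x; x \<le> y; y \<le> 1\<rbrakk> \<Longrightarrow> \<bar>m x - m y\<bar> \<le> g x - g y"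
  unfolding dominates_increments_def by blast

lemma variation_to_top_le:
  assumes "dominates_increments g m \<alpha>" "\<alpha> \<le> 1"
  shows "variation_to_top m \<alpha> \<le> g \<alpha> - g 1"
  unfolding variation_to_top_def
proof (rule cInf_lower)
  show "g \<alpha> - g 1 \<in> {g \<alpha> - g 1 |g. dominates_increments g m \<alpha>}" using assms by blast
  have "0 \<le> h \<alpha> - h 1" if "dominates_increments h m \<alpha>" for h
    using dominates_incrementsD[OF that, of \<alpha> 1] assms(2) by linarith
  then show "bdd_below {g \<alpha> - g 1 |g. dominates_increments g m \<alpha>}"
    by (intro bdd_belowI[of _ 0]) blast
qed

lemma variation_to_top_greatest:
  assumes "dominates_increments g m \<alpha>"
    and "\<And>h. dominates_increments h m \<alpha> \<Longrightarrow> c \<le> h \<alpha> - h 1"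
  shows "c \<le> variation_to_top m \<alpha>"
  unfolding variation_to_top_def
proof (rule cInf_greatest)
  show "{h \<alpha> - h 1 |h. dominates_increments h m \<alpha>} \<noteq> {}" using assms(1) by blast
next
  fix y assume "y \<in> {h \<alpha> - h 1 |h. dominates_increments h m \<alpha>}"
  then obtain h where "y = h \<alpha> - h 1" "dominates_increments h m \<alpha>" by blast
  then show "c \<le> y" using assms(2) by simp
qed

lemma variation_to_top_cong:
  assumes "\<And>x. \<alpha> \<le> x \<Longrightarrow> x \<le> 1 \<Longrightarrow> m x = m' x"
  shows "variation_to_top m \<alpha> = variation_to_top m' \<alpha>"
proof -
  have "dominates_increments g m \<alpha> \<longleftrightarrow> dominates_increments g m' \<alpha>" for g
  proof -
    have "(\<alpha> \<le> x \<and> x \<le> y \<and> y \<le> 1 \<longrightarrow> \<bar>m x - m y\<bar> \<le> g x - g y) \<longleftrightarrow>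
        (\<alpha> \<le> x \<and> x \<le> y \<and> y \<le> 1 \<longrightarrow> \<bar>m' x - m' y\<bar> \<le> g x - g y)" for x y
      using assms[of x] assms[of y] by auto
    then show ?thesis unfolding dominates_increments_def by blast
  qed
  then show ?thesis unfolding variation_to_top_def by simp
qed

lemma variation_to_top_step:
  assumes g: "dominates_increments g m \<alpha>" and \<alpha>\<beta>: "\<alpha> \<le> \<beta>" "\<beta> \<le> 1"
  shows "\<bar>m \<alpha> - m \<beta>\<bar> \<le> variation_to_top m \<alpha> - variation_to_top m \<beta>"
proof -
  have "\<bar>m \<alpha> - m \<beta>\<bar> + variation_to_top m \<beta> \<le> variation_to_top m \<alpha>"
  proof (rule variation_to_top_greatest[OF g])
    fix h assume h: "dominates_increments h m \<alpha>"
    then have "dominates_increments h m \<beta>"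
      using \<alpha>\<beta> unfolding dominates_increments_def by (meson order_trans)
    then have "variation_to_top m \<beta> \<le> h \<beta> - h 1" using \<alpha>\<beta> by (intro variation_to_top_le)
    moreover have "\<bar>m \<alpha> - m \<beta>\<bar> \<le> h \<alpha> - h \<beta>" using dominates_incrementsD[OF h] \<alpha>\<beta> by simp
    ultimately show "\<bar>m \<alpha> - m \<beta>\<bar> + variation_to_top m \<beta> \<le> h \<alpha> - h 1" by linarith
  qed
  then show ?thesis by linarith
qed

text \<open>A function that dominates on \<open>[\<beta>, 1]\<close> can be continued by \<open>g\<close> on \<open>[\<alpha>, \<beta>]\<close>, so the variation on
  \<open>[\<alpha>, 1]\<close> exceeds the one on \<open>[\<beta>, 1]\<close> by no more than the decrease of \<open>g\<close> in between.\<close>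

lemma variation_to_top_increment_le:
  assumes g: "dominates_increments g m \<alpha>" and \<alpha>\<beta>: "\<alpha> \<le> \<beta>" "\<beta> \<le> 1"
  shows "variation_to_top m \<alpha> - variation_to_top m \<beta> \<le> g \<alpha> - g \<beta>"
proof -
  have "dominates_increments g m \<beta>"
    using g \<alpha>\<beta> unfolding dominates_increments_def by (meson order_trans)
  then have "variation_to_top m \<alpha> - (g \<alpha> - g \<beta>) \<le> variation_to_top m \<beta>"
  proof (rule variation_to_top_greatest)
    fix h assume h: "dominates_increments h m \<beta>"
    define glue where "glue x = (if x \<le> \<beta> then g x - g \<beta> + h \<beta> else h x)" for x
    have "dominates_increments glue m \<alpha>"
      unfolding dominates_increments_def
    proof (intro allI impI; elim conjE)
      fix x y assume xy: "\<alpha> \<le> x" "x \<le> y" "y \<le> 1"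
      consider "y \<le> \<beta>" | "x \<le> \<beta>" "\<beta> < y" | "\<beta> < x" using xy by linarith
      then show "\<bar>m x - m y\<bar> \<le> glue x - glue y"
      proof cases
        case 1
        then show ?thesis using dominates_incrementsD[OF g xy] xy by (simp add: glue_def)
      next
        case 2
        then have "\<bar>m x - m \<beta>\<bar> \<le> g x - g \<beta>" "\<bar>m \<beta> - m y\<bar> \<le> h \<beta> - h y"
          using dominates_incrementsD[OF g, of x \<beta>] dominates_incrementsD[OF h, of \<beta> y] xy \<alpha>\<beta>
          by simp_all
        then show ?thesis using 2 by (simp add: glue_def)
      next
        case 3
        then show ?thesis using dominates_incrementsD[OF h, of x y] xy by (simp add: glue_def)
      qed
    qed
    then have "variation_to_top m \<alpha> \<le> glue \<alpha> - glue 1"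
      using \<alpha>\<beta> by (intro variation_to_top_le) simp_all
    also have "\<dots> = (g \<alpha> - g \<beta>) + (h \<beta> - h 1)"
      using \<alpha>\<beta> by (auto simp: glue_def)
    finally show "variation_to_top m \<alpha> - (g \<alpha> - g \<beta>) \<le> h \<beta> - h 1" by simp
  qed
  then show ?thesis by linarith
qed

text \<open>The increments of \<open>a\<close> and of \<open>- b\<close> are nonnegative, so their difference is bounded in absolute
  value by their sum. For \<open>m = a + b\<close> this supplies the dominating function that all facts about the
  variation require.\<close>

lemma (in endpoints) width_dominates_midpoint:
  assumes "0 < \<alpha>"
  shows "dominates_increments (\<lambda>x. b x - a x) (\<lambda>x. a x + b x) \<alpha>"
  unfolding dominates_increments_def
proof (intro allI impI; elim conjE)
  fix x y assume xy: "\<alpha> \<le> x" "x \<le> y" "y \<le> 1"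
  with mono[of x y] assms show "\<bar>a x + b x - (a y + b y)\<bar> \<le> b x - a x - (b y - a y)" by linarith
qed

lemma (in endpoints) variation_bounds:
  assumes "0 < \<alpha>" "\<alpha> \<le> \<beta>" "\<beta> \<le> 1"
  defines "V \<equiv> variation_to_top (\<lambda>x. a x + b x)"
  shows "\<bar>a \<alpha> + b \<alpha> - (a \<beta> + b \<beta>)\<bar> \<le> V \<alpha> - V \<beta>"
    and "V \<alpha> - V \<beta> \<le> (b \<alpha> - a \<alpha>) - (b \<beta> - a \<beta>)"
    and "V 1 = 0"
proof -
  show "\<bar>a \<alpha> + b \<alpha> - (a \<beta> + b \<beta>)\<bar> \<le> V \<alpha> - V \<beta>"
    unfolding V_def
    by (rule variation_to_top_step[OF width_dominates_midpoint[OF assms(1)] assms(2,3)])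
  show "V \<alpha> - V \<beta> \<le> (b \<alpha> - a \<alpha>) - (b \<beta> - a \<beta>)"
    unfolding V_def
    by (rule variation_to_top_increment_le[OF width_dominates_midpoint[OF assms(1)] assms(2,3)])
  have dom: "dominates_increments (\<lambda>x. b x - a x) (\<lambda>x. a x + b x) 1"
    by (rule width_dominates_midpoint) simp
  show "V 1 = 0"
    unfolding V_def
    using variation_to_top_le[OF dom] variation_to_top_greatest[OF dom, of 0] by fastforce
qed

text \<open>The first pair is nested because \<open>V\<close> dominates the increments of \<open>a + b\<close>, the second because the
  width decreases at least as fast as \<open>V\<close>. Their increments are thereby bounded by those of \<open>a\<close> and
  \<open>b\<close>, from which left continuity is inherited.\<close>

lemma (in endpoints) core_endpoints:
  defines "V \<equiv> variation_to_top (\<lambda>x. a x + b x)"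
  shows "endpoints (\<lambda>\<alpha>. (a \<alpha> + b \<alpha> - V \<alpha>) / 2) (\<lambda>\<alpha>. (a \<alpha> + b \<alpha> + V \<alpha>) / 2)" (is ?core)
    and "endpoints (\<lambda>\<alpha>. - ((b \<alpha> - a \<alpha> - V \<alpha>) / 2)) (\<lambda>\<alpha>. (b \<alpha> - a \<alpha> - V \<alpha>) / 2)" (is ?sym)
proof -
  note bounds = variation_bounds[folded V_def]
  have V1: "V 1 = 0" using bounds(3)[of 1 1] by simp
  have V: "0 \<le> V \<alpha>" "V \<alpha> \<le> b \<alpha> - a \<alpha>" if "0 < \<alpha>" "\<alpha> \<le> 1" for \<alpha>
    using bounds(1,2)[of \<alpha> 1] that V1 top by auto
  obtain B where B: "\<forall>\<alpha>. 0 < \<alpha> \<and> \<alpha> \<le> 1 \<longrightarrow> - B \<le> a \<alpha> \<and> b \<alpha> \<le> B" using bounded by blast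
  show ?core
  proof
    show "(a \<alpha> + b \<alpha> - V \<alpha>) / 2 \<le> (a \<beta> + b \<beta> - V \<beta>) / 2 \<and>
        (a \<beta> + b \<beta> + V \<beta>) / 2 \<le> (a \<alpha> + b \<alpha> + V \<alpha>) / 2"
      if "0 < \<alpha>" "\<alpha> \<le> \<beta>" "\<beta> \<le> 1" for \<alpha> \<beta>
      using bounds(1)[OF that] by (auto simp: divide_simps)
    show "(a 1 + b 1 - V 1) / 2 \<le> (a 1 + b 1 + V 1) / 2" using V1 by simp
    show "\<exists>\<beta>. 0 < \<beta> \<and> \<beta> < \<alpha> \<and> (a \<alpha> + b \<alpha> - V \<alpha>) / 2 - e < (a \<beta> + b \<beta> - V \<beta>) / 2 \<and>
        (a \<beta> + b \<beta> + V \<beta>) / 2 < (a \<alpha> + b \<alpha> + V \<alpha>) / 2 + e"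
      if \<alpha>: "0 < \<alpha>" "\<alpha> \<le> 1" "0 < e" for \<alpha> e
    proof -
      obtain \<beta> where \<beta>: "0 < \<beta>" "\<beta> < \<alpha>" "a \<alpha> - e < a \<beta>" "b \<beta> < b \<alpha> + e"
        using left_cont[OF \<alpha>] by blast
      then have "V \<beta> - V \<alpha> \<le> (b \<beta> - a \<beta>) - (b \<alpha> - a \<alpha>)" using bounds(2)[of \<beta> \<alpha>] \<alpha> by simp
      with \<beta> show ?thesis by (intro exI[of _ \<beta>]) (simp add: field_simps)
    qed
    have "- B \<le> (a \<alpha> + b \<alpha> - V \<alpha>) / 2 \<and> (a \<alpha> + b \<alpha> + V \<alpha>) / 2 \<le> B" if "0 < \<alpha> \<and> \<alpha> \<le> 1" for \<alpha>
      using B[rule_format, OF that] V[of \<alpha>] that by (simp add: field_simps)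
    then show "\<exists>B. \<forall>\<alpha>. 0 < \<alpha> \<and> \<alpha> \<le> 1 \<longrightarrow>
        - B \<le> (a \<alpha> + b \<alpha> - V \<alpha>) / 2 \<and> (a \<alpha> + b \<alpha> + V \<alpha>) / 2 \<le> B" by blast
  qed
  show ?sym
  proof
    show "- ((b \<alpha> - a \<alpha> - V \<alpha>) / 2) \<le> - ((b \<beta> - a \<beta> - V \<beta>) / 2) \<and>
        (b \<beta> - a \<beta> - V \<beta>) / 2 \<le> (b \<alpha> - a \<alpha> - V \<alpha>) / 2"
      if "0 < \<alpha>" "\<alpha> \<le> \<beta>" "\<beta> \<le> 1" for \<alpha> \<beta>
      using bounds(2)[OF that] by (simp add: field_simps)
    show "- ((b 1 - a 1 - V 1) / 2) \<le> (b 1 - a 1 - V 1) / 2"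
      unfolding V1 using top by (simp add: field_simps)
    show "\<exists>\<beta>. 0 < \<beta> \<and> \<beta> < \<alpha> \<and> - ((b \<alpha> - a \<alpha> - V \<alpha>) / 2) - e < - ((b \<beta> - a \<beta> - V \<beta>) / 2) \<and>
        (b \<beta> - a \<beta> - V \<beta>) / 2 < (b \<alpha> - a \<alpha> - V \<alpha>) / 2 + e"
      if \<alpha>: "0 < \<alpha>" "\<alpha> \<le> 1" "0 < e" for \<alpha> e
    proof -
      obtain \<beta> where \<beta>: "0 < \<beta>" "\<beta> < \<alpha>" "a \<alpha> - e < a \<beta>" "b \<beta> < b \<alpha> + e"
        using left_cont[OF \<alpha>] by blast
      then have "V \<alpha> \<le> V \<beta>" using bounds(1)[of \<beta> \<alpha>] \<alpha> by simp
      with \<beta> show ?thesis by (intro exI[of _ \<beta>]) (simp add: field_simps)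
    qed
    have "- B \<le> - ((b \<alpha> - a \<alpha> - V \<alpha>) / 2) \<and> (b \<alpha> - a \<alpha> - V \<alpha>) / 2 \<le> B" if "0 < \<alpha> \<and> \<alpha> \<le> 1" for \<alpha>
      using B[rule_format, OF that] V[of \<alpha>] that by (simp add: field_simps)
    then show "\<exists>B. \<forall>\<alpha>. 0 < \<alpha> \<and> \<alpha> \<le> 1 \<longrightarrow>
        - B \<le> - ((b \<alpha> - a \<alpha> - V \<alpha>) / 2) \<and> (b \<alpha> - a \<alpha> - V \<alpha>) / 2 \<le> B" by blast
  qed
qed

section \<open>The core in dimension one\<close>

lemma core_decomposition:
  fixes u :: "real ^ 'n \<Rightarrow> real"
  assumes n: "CARD('n) = 1" and u: "has_cuts u a b"
  defines "V \<equiv> variation_to_top (\<lambda>x. a x + b x)"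
  obtains v w :: "real ^ 'n \<Rightarrow> real"
  where "has_cuts v (\<lambda>\<alpha>. (a \<alpha> + b \<alpha> - V \<alpha>) / 2) (\<lambda>\<alpha>. (a \<alpha> + b \<alpha> + V \<alpha>) / 2)"
    and "has_cuts w (\<lambda>\<alpha>. - ((b \<alpha> - a \<alpha> - V \<alpha>) / 2)) (\<lambda>\<alpha>. (b \<alpha> - a \<alpha> - V \<alpha>) / 2)"
    and "w \<in> symmetric_fuzzy_vectors" and "u = v \<oplus>\<^sub>F w"
proof -
  note ep = endpoints.core_endpoints[OF has_cutsD(1)[OF u], folded V_def]
  obtain v :: "real ^ 'n \<Rightarrow> real"
    where v: "has_cuts v (\<lambda>\<alpha>. (a \<alpha> + b \<alpha> - V \<alpha>) / 2) (\<lambda>\<alpha>. (a \<alpha> + b \<alpha> + V \<alpha>) / 2)"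
    using has_cuts_exists[OF ep(1)] by blast
  obtain w :: "real ^ 'n \<Rightarrow> real"
    where w: "has_cuts w (\<lambda>\<alpha>. - ((b \<alpha> - a \<alpha> - V \<alpha>) / 2)) (\<lambda>\<alpha>. (b \<alpha> - a \<alpha> - V \<alpha>) / 2)"
    using has_cuts_exists[OF ep(2)] by blast
  have "u = v \<oplus>\<^sub>F w"
    by (rule has_cuts_determines_vector[OF u has_cuts_add[OF v w]]) (simp add: field_simps)
  then show ?thesis
    using that v w centred_cuts_imp_symmetric[OF n w] by blast
qed

lemma symmetric_summand_keeps_midpoint:
  assumes v: "has_cuts v c d" and w: "w \<in> symmetric_fuzzy_vectors" "has_cuts w s r"
    and u: "has_cuts (v \<oplus>\<^sub>F w) a b" and \<alpha>: "0 < \<alpha>" "\<alpha> \<le> 1"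
  shows "a \<alpha> = c \<alpha> - r \<alpha>" "b \<alpha> = d \<alpha> + r \<alpha>"
  using has_cuts_determines_endpoints[OF u has_cuts_add[OF v w(2)] \<alpha>] symmetric_has_cuts[OF w \<alpha>]
  by auto

text \<open>If \<open>v\<close> is skew, the symmetric part in its own core decomposition is trivial. Conversely, a summand
  \<open>x\<close> of \<open>v\<close> with symmetric complement has the same midpoints, so its width is also at least their
  variation; if \<open>v\<close> has just that width, nothing is left for the complement.\<close>

lemma skew_iff_width_eq_variation:
  fixes v :: "real ^ 'n \<Rightarrow> real"
  assumes n: "CARD('n) = 1" and v: "has_cuts v a b"
  shows "skew_fuzzy_vector v \<longleftrightarrow>
    (\<forall>\<alpha>. 0 < \<alpha> \<and> \<alpha> \<le> 1 \<longrightarrow> b \<alpha> - a \<alpha> = variation_to_top (\<lambda>x. a x + b x) \<alpha>)"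
    (is "_ \<longleftrightarrow> (\<forall>\<alpha>. _ \<longrightarrow> _ = ?V \<alpha>)")
proof (intro iffI allI impI)
  fix \<alpha> :: real
  assume skew: "skew_fuzzy_vector v" and \<alpha>: "0 < \<alpha> \<and> \<alpha> \<le> 1"
  obtain c w :: "real ^ 'n \<Rightarrow> real"
    where c: "has_cuts c (\<lambda>\<alpha>. (a \<alpha> + b \<alpha> - ?V \<alpha>) / 2) (\<lambda>\<alpha>. (a \<alpha> + b \<alpha> + ?V \<alpha>) / 2)"
      and w: "has_cuts w (\<lambda>\<alpha>. - ((b \<alpha> - a \<alpha> - ?V \<alpha>) / 2)) (\<lambda>\<alpha>. (b \<alpha> - a \<alpha> - ?V \<alpha>) / 2)"
        "w \<in> symmetric_fuzzy_vectors" and eq: "v = c \<oplus>\<^sub>F w"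
    using core_decomposition[OF n v] by blast
  have "w = fuzzy_origin"
    using skew has_cuts_imp_fuzzy_vector[OF c] w(2) eq unfolding skew_fuzzy_vector_def by blast
  then have "(b \<alpha> - a \<alpha> - ?V \<alpha>) / 2 = 0"
    using has_cuts_determines_endpoints[OF w(1), of "\<lambda>_. 0" "\<lambda>_. 0" \<alpha>] fuzzy_origin_has_cuts \<alpha> by simp
  then show "b \<alpha> - a \<alpha> = ?V \<alpha>" by simp
next
  assume width: "\<forall>\<alpha>. 0 < \<alpha> \<and> \<alpha> \<le> 1 \<longrightarrow> b \<alpha> - a \<alpha> = ?V \<alpha>"
  show "skew_fuzzy_vector v"
    unfolding skew_fuzzy_vector_def
  proof (intro conjI ballI impI)
    show "v \<in> fuzzy_vectors" using has_cuts_imp_fuzzy_vector[OF v] .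
    fix x w :: "real ^ 'n \<Rightarrow> real"
    assume x: "x \<in> fuzzy_vectors" and w: "w \<in> symmetric_fuzzy_vectors" and eq: "v = x \<oplus>\<^sub>F w"
    obtain c d where cd: "has_cuts x c d" using fuzzy_vector_has_cuts[OF n x] .
    have "w \<in> fuzzy_vectors" using w symmetric_iff_radial by blast
    then obtain s r where sr: "has_cuts w s r" using fuzzy_vector_has_cuts[OF n] by blast
    note ends = symmetric_summand_keeps_midpoint[OF cd w sr v[unfolded eq]]
    interpret x: endpoints c d using has_cutsD(1)[OF cd] .
    have "s \<alpha> = 0 \<and> r \<alpha> = 0" if \<alpha>: "0 < \<alpha>" "\<alpha> \<le> 1" for \<alpha>
    proof -
      have "?V \<alpha> = variation_to_top (\<lambda>x. c x + d x) \<alpha>"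
        by (rule variation_to_top_cong) (use ends \<alpha> in simp)
      also have "\<dots> \<le> d \<alpha> - c \<alpha>"
        using x.variation_bounds(2,3)[of \<alpha> 1] \<alpha> x.top by simp
      finally have "b \<alpha> - a \<alpha> \<le> d \<alpha> - c \<alpha>" using width \<alpha> by simp
      then have "r \<alpha> \<le> 0" using ends[OF \<alpha>] by linarith
      moreover have "s \<alpha> = - r \<alpha>" using symmetric_has_cuts[OF w sr \<alpha>] .
      ultimately show ?thesis using endpoints.ordered[OF has_cutsD(1)[OF sr] \<alpha>] by linarith
    qed
    then show "w = fuzzy_origin"
      by (rule has_cuts_determines_vector[OF sr fuzzy_origin_has_cuts])
  qed
qed

text \<open>The midpoints of a core are those of \<open>u\<close>, and skewness fixes its width as their variation.\<close>

lemma unique_core_one_dimensional: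
  fixes u :: "real ^ 'n \<Rightarrow> real"
  assumes n: "CARD('n) = 1" and u: "u \<in> fuzzy_vectors"
  shows "\<exists>!v. mares_core v u"
proof -
  obtain a b where ab: "has_cuts u a b" using fuzzy_vector_has_cuts[OF n u] .
  let ?V = "variation_to_top (\<lambda>x. a x + b x)"
  obtain c w :: "real ^ 'n \<Rightarrow> real"
    where c: "has_cuts c (\<lambda>\<alpha>. (a \<alpha> + b \<alpha> - ?V \<alpha>) / 2) (\<lambda>\<alpha>. (a \<alpha> + b \<alpha> + ?V \<alpha>) / 2)"
      and w: "w \<in> symmetric_fuzzy_vectors" and eq: "u = c \<oplus>\<^sub>F w"
    using core_decomposition[OF n ab] by blast
  have mid: "(m - v) / 2 + (m + v) / 2 = m" and width: "(m + v) / 2 - (m - v) / 2 = v" for m v :: real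
    by (simp_all add: field_simps)
  have "skew_fuzzy_vector c"
    unfolding skew_iff_width_eq_variation[OF n c] mid width by blast
  then have "mares_core c u"
    unfolding mares_core_def using has_cuts_imp_fuzzy_vector[OF c] w eq by blast
  moreover have "v = c" if core: "mares_core v u" for v
  proof -
    obtain w where v: "v \<in> fuzzy_vectors" "skew_fuzzy_vector v"
      and w: "w \<in> symmetric_fuzzy_vectors" and eq: "u = v \<oplus>\<^sub>F w"
      using core unfolding mares_core_def by blast
    obtain p q where pq: "has_cuts v p q" using fuzzy_vector_has_cuts[OF n v(1)] .
    have "w \<in> fuzzy_vectors" using w symmetric_iff_radial by blast
    then obtain s r where sr: "has_cuts w s r" using fuzzy_vector_has_cuts[OF n] by blast
    note ends = symmetric_summand_keeps_midpoint[OF pq w sr ab[unfolded eq]]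
    show ?thesis
    proof (rule has_cuts_determines_vector[OF pq c])
      fix \<alpha> :: real assume \<alpha>: "0 < \<alpha>" "\<alpha> \<le> 1"
      have "q \<alpha> - p \<alpha> = variation_to_top (\<lambda>x. p x + q x) \<alpha>"
        using v(2) \<alpha> unfolding skew_iff_width_eq_variation[OF n pq] by blast
      also have "\<dots> = ?V \<alpha>"
        by (rule variation_to_top_cong) (use ends \<alpha> in simp)
      finally show "p \<alpha> = (a \<alpha> + b \<alpha> - ?V \<alpha>) / 2 \<and> q \<alpha> = (a \<alpha> + b \<alpha> + ?V \<alpha>) / 2"
        using ends[OF \<alpha>] by (simp add: field_simps)
    qed
  qed
  ultimately show ?thesis by blast
qed

theorem theorem3p4p10:
  shows "(\<forall>u \<in> (fuzzy_vectors :: (real ^ 'n \<Rightarrow> real) set). \<exists>!v. mares_core v u)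
           \<longleftrightarrow> CARD('n) = 1"
proof
  assume unique: "\<forall>u \<in> (fuzzy_vectors :: (real ^ 'n \<Rightarrow> real) set). \<exists>!v. mares_core v u"
  show "CARD('n) = 1"
  proof (rule ccontr)
    assume "CARD('n) \<noteq> 1"
    then obtain u v v' :: "real ^ 'n \<Rightarrow> real"
      where "u \<in> fuzzy_vectors" "mares_core v u" "mares_core v' u" "v \<noteq> v'"
      by (rule two_cores)
    then show False using unique by blast
  qed
next
  assume "CARD('n) = 1"
  then show "\<forall>u \<in> (fuzzy_vectors :: (real ^ 'n \<Rightarrow> real) set). \<exists>!v. mares_core v u"
    using unique_core_one_dimensional by blast
qed

end
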